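(* Let $V$ be a finite-dimensional vector space with a linear (rational) action of an algebraic group $G$. Then a closed subvariety $X\subset V$ is $G$-symmetric if and only if it is stable under $\operatorname{End}_G(V)$, i.e. $\phi(X)\subset X$ for all $\phi\in\operatorname{End}_G(V)$.
   Context: $\Bbbk$ is algebraically closed of characteristic $0$. Vector fields on $V$ are identified with polynomial maps $\xi\colon V\to V$ ($\xi(v)\in V=T_vV$); such $\xi$ is $G$-invariant if $\xi(gv)=g\xi(v)$ for all $g\in G$, $v\in V$. A closed subvariety $X\subset V$ is $G$-symmetric if $\xi(x)\in T_xX$ for all $x\in X$ and all $G$-invariant vector fields $\xi$ on $V$. $\operatorname{End}_G(V)$ is the set of $G$-equivariant polynomial maps $V\to V$. *)

theory Defs
  imports "HOL-Analysis.Analysis" "HOL-Computational_Algebra.Polynomial" "HOL-Algebra.Group"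
begin

text \<open>The vector space V is k^n (coordinates chosen), modelled as the type 'k ^ 'n
  for a finite index type 'n.  Polynomial functions on V are the functions generated
  by constants and coordinate functions under addition and multiplication.\<close>

inductive_set poly_fun :: "('k::comm_ring_1 ^ 'n::finite \<Rightarrow> 'k) set" where
  const: "(\<lambda>x. c) \<in> poly_fun"
| coord: "(\<lambda>x. x $ i) \<in> poly_fun"
| add: "f \<in> poly_fun \<Longrightarrow> g \<in> poly_fun \<Longrightarrow> (\<lambda>x. f x + g x) \<in> poly_fun"
| mult: "f \<in> poly_fun \<Longrightarrow> g \<in> poly_fun \<Longrightarrow> (\<lambda>x. f x * g x) \<in> poly_fun"

text \<open>Polynomial maps V \<rightarrow> V (= polynomial vector fields on V).\<close>
definition poly_map :: "('k::comm_ring_1 ^ 'n::finite \<Rightarrow> 'k ^ 'n) \<Rightarrow> bool" where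
  "poly_map \<phi> \<longleftrightarrow> (\<forall>i. (\<lambda>x. \<phi> x $ i) \<in> poly_fun)"

text \<open>Zariski closed subsets of V: common zero sets of families of polynomial functions.\<close>
definition zariski_closed :: "('k::comm_ring_1 ^ 'n::finite) set \<Rightarrow> bool" where
  "zariski_closed X \<longleftrightarrow> (\<exists>F \<subseteq> poly_fun. X = {x. \<forall>f\<in>F. f x = 0})"

text \<open>Directional derivative of a polynomial function f at x in direction v:
  the linear coefficient of the univariate polynomial t \<mapsto> f (x + t v)
  (unique, since the field is infinite).\<close>
definition dir_deriv :: "('k::field ^ 'n::finite \<Rightarrow> 'k) \<Rightarrow> 'k ^ 'n \<Rightarrow> 'k ^ 'n \<Rightarrow> 'k" where
  "dir_deriv f x v = coeff (THE p. \<forall>t. poly p t = f (x + t *s v)) 1"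

text \<open>Zariski tangent space T_x X: the common kernel of the differentials at x of all
  polynomial functions vanishing on X.\<close>
definition tangent_space :: "('k::field ^ 'n::finite) set \<Rightarrow> 'k ^ 'n \<Rightarrow> ('k ^ 'n) set" where
  "tangent_space X x =
     {v. \<forall>f \<in> poly_fun. (\<forall>y\<in>X. f y = 0) \<longrightarrow> dir_deriv f x v = 0}"

text \<open>A linear action of a group G (HOL-Algebra) on V.\<close>
definition linear_action :: "('g, 'b) monoid_scheme \<Rightarrow> ('g \<Rightarrow> 'k::field ^ 'n::finite \<Rightarrow> 'k ^ 'n) \<Rightarrow> bool" where
  "linear_action G act \<longleftrightarrow>
     (\<forall>g \<in> carrier G. Vector_Spaces.linear (*s) (*s) (act g)) \<and>
     act \<one>\<^bsub>G\<^esub> = id \<and>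
     (\<forall>g \<in> carrier G. \<forall>h \<in> carrier G. act (g \<otimes>\<^bsub>G\<^esub> h) = act g \<circ> act h)"

text \<open>G-invariant vector fields on V (vector fields identified with polynomial maps V \<rightarrow> V).\<close>
definition invariant_vector_field ::
  "('g, 'b) monoid_scheme \<Rightarrow> ('g \<Rightarrow> 'k::field ^ 'n::finite \<Rightarrow> 'k ^ 'n) \<Rightarrow> ('k ^ 'n \<Rightarrow> 'k ^ 'n) \<Rightarrow> bool" where
  "invariant_vector_field G act \<xi> \<longleftrightarrow>
     poly_map \<xi> \<and> (\<forall>g \<in> carrier G. \<forall>v. \<xi> (act g v) = act g (\<xi> v))"

text \<open>End_G(V): G-equivariant polynomial maps V \<rightarrow> V.\<close>
definition End_G ::
  "('g, 'b) monoid_scheme \<Rightarrow> ('g \<Rightarrow> 'k::field ^ 'n::finite \<Rightarrow> 'k ^ 'n) \<Rightarrow> ('k ^ 'n \<Rightarrow> 'k ^ 'n) set" where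
  "End_G G act = {\<phi>. poly_map \<phi> \<and> (\<forall>g \<in> carrier G. \<forall>v. \<phi> (act g v) = act g (\<phi> v))}"

text \<open>G-symmetric closed subsets.\<close>
definition G_symmetric ::
  "('g, 'b) monoid_scheme \<Rightarrow> ('g \<Rightarrow> 'k::field ^ 'n::finite \<Rightarrow> 'k ^ 'n) \<Rightarrow> ('k ^ 'n) set \<Rightarrow> bool" where
  "G_symmetric G act X \<longleftrightarrow>
     (\<forall>\<xi>. invariant_vector_field G act \<xi> \<longrightarrow> (\<forall>x\<in>X. \<xi> x \<in> tangent_space X x))"

end

theory Submission
  imports Defs
begin

text \<open>
  If X is stable under End_G(V) and \<xi> is an invariant vector field, then every
  y \<mapsto> y + t \<xi>(y) is equivariant, so X contains the lines x + t \<xi>(x) and \<xi>(x) is tangent.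

  Conversely, let X be G-symmetric, \<phi> equivariant and \<eta> = \<phi> - id, so \<phi>(x) = x + \<eta>(x).
  For f in the ideal of X let c_k(f,\<eta>)(y) be the k-th Taylor coefficient of t \<mapsto> f(y + t \<eta>(y)).
  Differentiating c_k(f,\<eta>) along \<eta> gives (k+1) c_(k+1)(f,\<eta>) plus the derivative in v of
  c_k(f, \<eta> + v d\<eta>(\<eta>)), where d\<eta>(\<eta>) is again equivariant. Since \<eta> is tangent to X, induction
  on k shows that all c_k(f,\<eta>) vanish on X, hence f(\<phi>(x)) = \<Sum>_k c_k(f,\<eta>)(x) = 0.
\<close>

definition poly_of :: "('k::field_char_0 \<Rightarrow> 'k) \<Rightarrow> 'k poly" where
  "poly_of h = (THE p. \<forall>t. poly p t = h t)"

definition poly_function :: "('k::field_char_0 \<Rightarrow> 'k) \<Rightarrow> bool" where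
  "poly_function h \<longleftrightarrow> (\<exists>p. \<forall>t. h t = poly p t)"

lemma poly_of_unique:
  assumes "\<And>t. poly p t = h t"
  shows "poly_of h = p"
proof -
  have "q = p" if "\<forall>t. poly q t = h t" for q
    using that assms poly_all_0_iff_0[of "q - p"] by simp
  then show ?thesis
    unfolding poly_of_def using assms by (intro the_equality) auto
qed

lemma poly_poly_of: "poly_function h \<Longrightarrow> poly (poly_of h) t = h t"
  unfolding poly_function_def using poly_of_unique by metis

lemma poly_of_poly [simp]: "poly_of (\<lambda>t. poly p t) = p"
  by (rule poly_of_unique) simp

lemma poly_of_const [simp]: "poly_of (\<lambda>t. c) = [:c:]"
  by (rule poly_of_unique) simp

lemma poly_function_poly [simp]: "poly_function (\<lambda>t. poly p t)"
  unfolding poly_function_def by blast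

lemma poly_function_const [simp]: "poly_function (\<lambda>t. c)"
  unfolding poly_function_def by (rule exI[of _ "[:c:]"]) simp

lemma poly_function_id [simp]: "poly_function (\<lambda>t. t)"
  unfolding poly_function_def by (rule exI[of _ "[:0, 1:]"]) simp

lemma poly_function_add:
  "poly_function f \<Longrightarrow> poly_function g \<Longrightarrow> poly_function (\<lambda>t. f t + g t)"
  unfolding poly_function_def by (metis poly_add)

lemma poly_function_mult:
  "poly_function f \<Longrightarrow> poly_function g \<Longrightarrow> poly_function (\<lambda>t. f t * g t)"
  unfolding poly_function_def by (metis poly_mult)

lemma poly_of_add:
  "poly_function f \<Longrightarrow> poly_function g \<Longrightarrow> poly_of (\<lambda>t. f t + g t) = poly_of f + poly_of g"
  by (rule poly_of_unique) (simp add: poly_poly_of)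

lemma poly_of_mult:
  "poly_function f \<Longrightarrow> poly_function g \<Longrightarrow> poly_of (\<lambda>t. f t * g t) = poly_of f * poly_of g"
  by (rule poly_of_unique) (simp add: poly_poly_of)

lemma coeff_0_poly_of: "poly_function h \<Longrightarrow> coeff (poly_of h) 0 = h 0"
  by (simp add: poly_poly_of flip: poly_0_coeff_0)

lemma coeff_1_mult:
  "coeff (p * q) (Suc 0) = coeff p 0 * coeff q (Suc 0) + coeff p (Suc 0) * coeff q 0"
  by (simp add: coeff_mult atMost_Suc algebra_simps)

lemma coeff_1_pcompose_shift: "coeff (pcompose p [:t, 1:]) (Suc 0) = poly (pderiv p) t"
  by (induction p)
    (auto simp: pcompose_pCons pderiv_pCons poly_pcompose algebra_simps simp flip: poly_0_coeff_0)

definition poly_curve :: "('k::field_char_0 \<Rightarrow> 'k ^ 'n::finite) \<Rightarrow> bool" where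
  "poly_curve w \<longleftrightarrow> (\<forall>i. poly_function (\<lambda>u. w u $ i))"

lemma poly_curve_line [simp]: "poly_curve (\<lambda>t. x + t *s v)"
  unfolding poly_curve_def by (simp add: poly_function_add poly_function_mult)

lemma poly_function_comp_poly_curve:
  assumes "f \<in> poly_fun" and "poly_curve w"
  shows "poly_function (\<lambda>t. f (w t))"
  using assms(1)
proof induction
  case (coord i)
  then show ?case using assms(2) unfolding poly_curve_def by simp
qed (simp_all add: poly_function_add poly_function_mult)

lemma poly_function_comp_line: "f \<in> poly_fun \<Longrightarrow> poly_function (\<lambda>t. f (x + t *s v))"
  using poly_function_comp_poly_curve poly_curve_line by blast

lemma poly_function_poly_map_line:
  "poly_map \<eta> \<Longrightarrow> poly_function (\<lambda>t. \<eta> (x + t *s v) $ i)"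
  unfolding poly_map_def using poly_function_comp_line[of "\<lambda>y. \<eta> y $ i"] by blast

lemma coeff_1_poly_of_comp_cong:
  assumes "f \<in> poly_fun" and w: "poly_curve w" and w': "poly_curve w'"
    and "w 0 = w' 0"
    and "\<And>i. coeff (poly_of (\<lambda>u. w u $ i)) 1 = coeff (poly_of (\<lambda>u. w' u $ i)) 1"
  shows "coeff (poly_of (\<lambda>u. f (w u))) 1 = coeff (poly_of (\<lambda>u. f (w' u))) 1"
  using assms(1)
proof induction
  case (add f g)
  then show ?case
    by (simp add: poly_of_add poly_function_comp_poly_curve[OF _ w]
        poly_function_comp_poly_curve[OF _ w'])
next
  case (mult f g)
  then show ?case using \<open>w 0 = w' 0\<close>
    by (simp add: poly_of_mult coeff_1_mult coeff_0_poly_of poly_function_comp_poly_curve[OF _ w]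
        poly_function_comp_poly_curve[OF _ w'])
qed (use assms(5) in simp_all)

lemma dir_deriv_poly_of: "dir_deriv f x v = coeff (poly_of (\<lambda>t. f (x + t *s v))) 1"
  unfolding dir_deriv_def poly_of_def ..

lemma dir_deriv_const: "dir_deriv (\<lambda>y. c) (x::'k::field_char_0 ^ 'n::finite) v = 0"
  by (simp add: dir_deriv_poly_of)

lemma dir_deriv_coord: "dir_deriv (\<lambda>y. y $ i) (x::'k::field_char_0 ^ 'n::finite) v = v $ i"
proof -
  have "poly_of (\<lambda>t. x $ i + t * v $ i) = [:x $ i, v $ i:]"
    by (rule poly_of_unique) (simp add: algebra_simps)
  then show ?thesis by (simp add: dir_deriv_poly_of)
qed

lemma dir_deriv_add:
  "f \<in> poly_fun \<Longrightarrow> g \<in> poly_fun \<Longrightarrow>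
    dir_deriv (\<lambda>y. f y + g y) (x::'k::field_char_0 ^ 'n::finite) v
      = dir_deriv f x v + dir_deriv g x v"
  by (simp add: dir_deriv_poly_of poly_of_add poly_function_comp_line)

lemma dir_deriv_mult:
  "f \<in> poly_fun \<Longrightarrow> g \<in> poly_fun \<Longrightarrow>
    dir_deriv (\<lambda>y. f y * g y) (x::'k::field_char_0 ^ 'n::finite) v
      = f x * dir_deriv g x v + dir_deriv f x v * g x"
  by (simp add: dir_deriv_poly_of poly_of_mult poly_function_comp_line coeff_1_mult coeff_0_poly_of)

lemma dir_deriv_add_direction:
  "f \<in> poly_fun \<Longrightarrow>
    dir_deriv f (x::'k::field_char_0 ^ 'n::finite) (v + w) = dir_deriv f x v + dir_deriv f x w"
  by (induction rule: poly_fun.induct)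
    (simp_all add: dir_deriv_const dir_deriv_coord dir_deriv_add dir_deriv_mult algebra_simps)

lemma dir_deriv_along_line:
  assumes "f \<in> poly_fun"
  shows "dir_deriv f (x + t *s b) b = poly (pderiv (poly_of (\<lambda>s. f (x + s *s b)))) t"
proof -
  let ?p = "poly_of (\<lambda>s. f (x + s *s b))"
  have "f (x + t *s b + u *s b) = poly ?p (t + u)" for u
    using poly_poly_of[OF poly_function_comp_line[OF assms], of x b "t + u"]
    by (simp add: vector_sadd_rdistrib add.assoc)
  then have "poly_of (\<lambda>u. f (x + t *s b + u *s b)) = pcompose ?p [:t, 1:]"
    by (intro poly_of_unique) (simp add: poly_pcompose)
  then show ?thesis by (simp add: dir_deriv_poly_of coeff_1_pcompose_shift)
qed

definition taylor_coeff ::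
  "('k::field_char_0 ^ 'n::finite \<Rightarrow> 'k) \<Rightarrow> ('k ^ 'n \<Rightarrow> 'k ^ 'n) \<Rightarrow> nat \<Rightarrow> 'k ^ 'n \<Rightarrow> 'k" where
  "taylor_coeff f \<eta> k x = coeff (poly_of (\<lambda>t. f (x + t *s \<eta> x))) k"

lemma poly_fun_sum:
  "finite A \<Longrightarrow> (\<And>a. a \<in> A \<Longrightarrow> f a \<in> poly_fun) \<Longrightarrow> (\<lambda>x. \<Sum>a\<in>A. f a x) \<in> poly_fun"
proof (induction A rule: finite_induct)
  case empty
  then show ?case using poly_fun.const[of 0] by simp
qed (simp add: poly_fun.add)

lemma poly_fun_taylor_coeff:
  assumes "f \<in> poly_fun" and \<eta>: "poly_map \<eta>"
  shows "taylor_coeff f \<eta> k \<in> poly_fun"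
  using assms(1) unfolding taylor_coeff_def[abs_def]
proof (induction arbitrary: k)
  case (const c)
  show ?case using poly_fun.const[of c] poly_fun.const[of 0] by (cases k) simp_all
next
  case (coord i)
  have e: "poly_of (\<lambda>t. x $ i + t * \<eta> x $ i) = [:x $ i, \<eta> x $ i:]" for x
    by (rule poly_of_unique) (simp add: algebra_simps)
  have \<eta>i: "(\<lambda>x. \<eta> x $ i) \<in> poly_fun"
    using \<eta> unfolding poly_map_def by blast
  show ?case
  proof (cases k)
    case (Suc m)
    then show ?thesis using \<eta>i poly_fun.const[of 0] by (cases m) (simp_all add: e)
  qed (simp add: e poly_fun.coord)
next
  case (add f g)
  then show ?case by (simp add: poly_of_add poly_function_comp_line poly_fun.add)
next
  case (mult f g)
  then show ?case
    by (simp add: poly_of_mult poly_function_comp_line coeff_mult poly_fun_sum poly_fun.mult)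
qed

lemma taylor_coeff_0: "f \<in> poly_fun \<Longrightarrow> taylor_coeff f \<eta> 0 = f"
  by (simp add: taylor_coeff_def coeff_0_poly_of poly_function_comp_line fun_eq_iff)

definition differential ::
  "('k::field_char_0 ^ 'n::finite \<Rightarrow> 'k ^ 'n) \<Rightarrow> 'k ^ 'n \<Rightarrow> 'k ^ 'n \<Rightarrow> 'k ^ 'n" where
  "differential \<eta> x v = (\<chi> i. dir_deriv (\<lambda>y. \<eta> y $ i) x v)"

lemma poly_map_self_differential:
  assumes "poly_map \<eta>"
  shows "poly_map (\<lambda>x. differential \<eta> x (\<eta> x))"
proof -
  have "(\<lambda>x. differential \<eta> x (\<eta> x) $ i) = taylor_coeff (\<lambda>y. \<eta> y $ i) \<eta> 1" for i
    by (simp add: differential_def dir_deriv_poly_of taylor_coeff_def fun_eq_iff)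
  moreover have "(\<lambda>y. \<eta> y $ i) \<in> poly_fun" for i
    using assms unfolding poly_map_def by blast
  ultimately show ?thesis
    unfolding poly_map_def by (simp add: poly_fun_taylor_coeff[OF _ assms])
qed

lemma differential_equivariant:
  assumes \<eta>: "poly_map \<eta>"
    and A: "Vector_Spaces.linear (*s) (*s) A" and comm: "\<And>v. \<eta> (A v) = A (\<eta> v)"
  shows "differential \<eta> (A x) (A v) = A (differential \<eta> x v)"
proof (rule vec_eq_iff[THEN iffD2], rule allI)
  fix i
  define m where "m j = A (axis j 1) $ i" for j
  have "\<eta> (A x + u *s A v) $ i = (\<Sum>j\<in>UNIV. \<eta> (x + u *s v) $ j * m j)" for u
  proof -
    have "A x + u *s A v = A (x + u *s v)"
      by (simp add: vec.linear_add[OF A] vec.linear_scale[OF A])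
    then have "\<eta> (A x + u *s A v) = A (\<eta> (x + u *s v))"
      by (simp add: comm)
    then show ?thesis
      using linear_componentwise[OF A, of "\<eta> (x + u *s v)" i] unfolding m_def by simp
  qed
  then have "poly_of (\<lambda>u. \<eta> (A x + u *s A v) $ i)
      = (\<Sum>j\<in>UNIV. smult (m j) (poly_of (\<lambda>u. \<eta> (x + u *s v) $ j)))"
    by (intro poly_of_unique)
      (simp add: poly_sum poly_poly_of[OF poly_function_poly_map_line[OF \<eta>]] mult.commute)
  then have "differential \<eta> (A x) (A v) $ i = (\<Sum>j\<in>UNIV. differential \<eta> x v $ j * m j)"
    by (simp add: differential_def dir_deriv_poly_of coeff_sum mult.commute)
  also have "\<dots> = A (differential \<eta> x v) $ i"
    unfolding m_def by (rule linear_componentwise[OF A, symmetric])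
  finally show "differential \<eta> (A x) (A v) $ i = A (differential \<eta> x v) $ i" .
qed

definition bipoly_function :: "('k::field_char_0 \<Rightarrow> 'k \<Rightarrow> 'k) \<Rightarrow> bool" where
  "bipoly_function B \<longleftrightarrow> (\<exists>P::'k poly poly. \<forall>u t. B u t = poly (poly P [:u:]) t)"

lemma bipoly_function_const [simp]: "bipoly_function (\<lambda>u t. c)"
  unfolding bipoly_function_def by (rule exI[of _ "[:[:c:]:]"]) simp

lemma bipoly_function_left [simp]: "bipoly_function (\<lambda>u t. u)"
  unfolding bipoly_function_def by (rule exI[of _ "[:0, 1:]"]) simp

lemma bipoly_function_right [simp]: "bipoly_function (\<lambda>u t. t)"
  unfolding bipoly_function_def by (rule exI[of _ "[:[:0, 1:]:]"]) simp

lemma bipoly_function_add: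
  "bipoly_function f \<Longrightarrow> bipoly_function g \<Longrightarrow> bipoly_function (\<lambda>u t. f u t + g u t)"
  unfolding bipoly_function_def by (metis poly_add)

lemma bipoly_function_mult:
  "bipoly_function f \<Longrightarrow> bipoly_function g \<Longrightarrow> bipoly_function (\<lambda>u t. f u t * g u t)"
  unfolding bipoly_function_def by (metis poly_mult)

lemma bipoly_function_comp:
  assumes "f \<in> poly_fun" and "\<And>i. bipoly_function (\<lambda>u t. w u t $ i)"
  shows "bipoly_function (\<lambda>u t. f (w u t))"
  using assms(1)
  by induction (simp_all add: assms(2) bipoly_function_add bipoly_function_mult)

lemma poly_poly_pCons_left: "poly (poly P [:u:]) t = poly (map_poly (\<lambda>q. poly q t) P) u"
  by (induction P) (auto simp: map_poly_pCons)

lemma coeff_poly_pCons_left: "coeff (poly P [:u:]) i = poly (map_poly (\<lambda>q. coeff q i) P) u"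
  by (induction P) (auto simp: map_poly_pCons)

lemma poly_function_coeff_poly_of_bipoly:
  assumes "bipoly_function B"
  shows "poly_function (\<lambda>t. coeff (poly_of (\<lambda>u. B u t)) j)"
proof -
  obtain P where P: "\<And>u t. B u t = poly (poly P [:u:]) t"
    using assms unfolding bipoly_function_def by blast
  show ?thesis
    by (simp add: P poly_poly_pCons_left coeff_map_poly)
qed

lemma coeff_poly_of_bipoly_swap:
  assumes "bipoly_function B"
  shows "coeff (poly_of (\<lambda>u. coeff (poly_of (\<lambda>t. B u t)) i)) j
       = coeff (poly_of (\<lambda>t. coeff (poly_of (\<lambda>u. B u t)) j)) i"
proof -
  obtain P where P: "\<And>u t. B u t = poly (poly P [:u:]) t"
    using assms unfolding bipoly_function_def by blast
  have "poly_of (\<lambda>t. B u t) = poly P [:u:]" for u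
    by (simp add: P)
  moreover have "poly_of (\<lambda>u. B u t) = map_poly (\<lambda>q. poly q t) P" for t
    by (simp add: P poly_poly_pCons_left)
  ultimately show ?thesis
    by (simp add: coeff_poly_pCons_left coeff_map_poly)
qed

lemma coeff_1_comp_line_field:
  fixes x :: "'k::field_char_0 ^ 'n::finite"
  assumes f: "f \<in> poly_fun" and \<eta>: "poly_map \<eta>"
  defines "b \<equiv> \<eta> x"
  shows "coeff (poly_of (\<lambda>u. f (x + u *s b + t *s \<eta> (x + u *s b)))) 1
    = dir_deriv f (x + t *s b) (b + t *s differential \<eta> x b)"
proof -
  have "coeff (poly_of (\<lambda>u. f (x + u *s b + t *s \<eta> (x + u *s b)))) 1
      = coeff (poly_of (\<lambda>u. f (x + t *s b + u *s (b + t *s differential \<eta> x b)))) 1"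
  proof (rule coeff_1_poly_of_comp_cong[OF f])
    show "poly_curve (\<lambda>u. x + u *s b + t *s \<eta> (x + u *s b))"
      unfolding poly_curve_def
      by (simp add: poly_function_poly_map_line[OF \<eta>] poly_function_add poly_function_mult)
    show "poly_curve (\<lambda>u. x + t *s b + u *s (b + t *s differential \<eta> x b))"
      by (rule poly_curve_line)
    show "x + 0 *s b + t *s \<eta> (x + 0 *s b) = x + t *s b + 0 *s (b + t *s differential \<eta> x b)"
      by (simp add: b_def)
    fix i
    have "poly_of (\<lambda>u. (x + u *s b + t *s \<eta> (x + u *s b)) $ i)
        = [:x $ i, b $ i:] + smult t (poly_of (\<lambda>u. \<eta> (x + u *s b) $ i))"
      by (intro poly_of_unique) (simp add: poly_poly_of[OF poly_function_poly_map_line[OF \<eta>]] algebra_simps)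
    moreover have "poly_of (\<lambda>u. (x + t *s b + u *s (b + t *s differential \<eta> x b)) $ i)
        = [:x $ i + t * b $ i, b $ i + t * differential \<eta> x b $ i:]"
      by (intro poly_of_unique) (simp add: algebra_simps)
    ultimately show "coeff (poly_of (\<lambda>u. (x + u *s b + t *s \<eta> (x + u *s b)) $ i)) 1
        = coeff (poly_of (\<lambda>u. (x + t *s b + u *s (b + t *s differential \<eta> x b)) $ i)) 1"
      by (simp add: differential_def dir_deriv_poly_of)
  qed
  then show ?thesis by (simp add: dir_deriv_poly_of)
qed

lemma dir_deriv_taylor_coeff:
  assumes f: "f \<in> poly_fun" and \<eta>: "poly_map \<eta>"
  shows "dir_deriv (taylor_coeff f \<eta> k) x (\<eta> x)
    = of_nat (Suc k) * taylor_coeff f \<eta> (Suc k) x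
      + coeff (poly_of (\<lambda>v. taylor_coeff f (\<lambda>y. \<eta> y + v *s differential \<eta> y (\<eta> y)) k x)) 1"
proof -
  define b z where "b = \<eta> x" and "z = differential \<eta> x b"
  define B where "B = (\<lambda>u t. f (x + u *s b + t *s \<eta> (x + u *s b)))"
  define B' where "B' = (\<lambda>v t. f (x + t *s (b + v *s z)))"
  define p where "p = poly_of (\<lambda>s. f (x + s *s b))"
  have "bipoly_function (\<lambda>u t. (x + u *s b + t *s \<eta> (x + u *s b)) $ i)" for i
  proof -
    have "bipoly_function (\<lambda>u t. (x + u *s b) $ i)" for i
      by (simp add: bipoly_function_add bipoly_function_mult)
    then have "bipoly_function (\<lambda>u t. \<eta> (x + u *s b) $ i)"
      using \<eta> bipoly_function_comp[of "\<lambda>y. \<eta> y $ i" "\<lambda>u t. x + u *s b"]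
      unfolding poly_map_def by blast
    then show ?thesis
      by (simp add: bipoly_function_add bipoly_function_mult)
  qed
  then have B: "bipoly_function B"
    unfolding B_def by (rule bipoly_function_comp[OF f, of "\<lambda>u t. x + u *s b + t *s \<eta> (x + u *s b)"])
  have "bipoly_function (\<lambda>v t. (x + t *s (b + v *s z)) $ i)" for i
    by (simp add: bipoly_function_add bipoly_function_mult)
  then have B': "bipoly_function B'"
    unfolding B'_def by (rule bipoly_function_comp[OF f, of "\<lambda>v t. x + t *s (b + v *s z)"])
  have B_split: "coeff (poly_of (\<lambda>u. B u t)) 1 = poly (pderiv p) t + coeff (poly_of (\<lambda>v. B' v t)) 1"
    for t
  proof -
    have "(\<lambda>v. B' v t) = (\<lambda>v. f (x + t *s b + v *s (t *s z)))"
      by (rule ext) (simp add: B'_def algebra_simps vector_smult_assoc mult.commute)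
    then have "dir_deriv f (x + t *s b) (t *s z) = coeff (poly_of (\<lambda>v. B' v t)) 1"
      by (simp only: dir_deriv_poly_of)
    moreover have "coeff (poly_of (\<lambda>u. B u t)) 1 = dir_deriv f (x + t *s b) (b + t *s z)"
      unfolding B_def z_def b_def by (rule coeff_1_comp_line_field[OF f \<eta>])
    ultimately show ?thesis
      by (simp add: dir_deriv_add_direction[OF f] dir_deriv_along_line[OF f] p_def)
  qed
  have "dir_deriv (taylor_coeff f \<eta> k) x b = coeff (poly_of (\<lambda>t. coeff (poly_of (\<lambda>u. B u t)) 1)) k"
    using coeff_poly_of_bipoly_swap[OF B, of k 1]
    by (simp add: dir_deriv_poly_of taylor_coeff_def B_def)
  also have "\<dots> = coeff (pderiv p) k + coeff (poly_of (\<lambda>t. coeff (poly_of (\<lambda>v. B' v t)) 1)) k"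
    unfolding B_split
    by (simp add: poly_of_add[OF poly_function_poly poly_function_coeff_poly_of_bipoly[OF B']])
  also have "coeff (poly_of (\<lambda>t. coeff (poly_of (\<lambda>v. B' v t)) 1)) k
      = coeff (poly_of (\<lambda>v. coeff (poly_of (\<lambda>t. B' v t)) k)) 1"
    using coeff_poly_of_bipoly_swap[OF B', of k 1] by simp
  finally show ?thesis
    by (simp add: coeff_pderiv p_def B'_def b_def z_def taylor_coeff_def[abs_def])
qed

lemma invariant_vector_field_iff_End_G:
  "invariant_vector_field G act \<xi> \<longleftrightarrow> \<xi> \<in> End_G G act"
  unfolding invariant_vector_field_def End_G_def by simp

lemma id_in_End_G: "(\<lambda>y. y) \<in> End_G G act"
  unfolding End_G_def poly_map_def by (simp add: poly_fun.coord)

lemma End_G_add_scale: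
  assumes act: "linear_action G act" and "\<phi> \<in> End_G G act" and "\<psi> \<in> End_G G act"
  shows "(\<lambda>y. \<phi> y + c *s \<psi> y) \<in> End_G G act"
proof -
  have "(\<lambda>y. \<phi> y $ i + (\<lambda>y. c) y * \<psi> y $ i) \<in> poly_fun" for i
    using assms(2,3) unfolding End_G_def poly_map_def
    by (intro poly_fun.add poly_fun.mult poly_fun.const) auto
  moreover have "\<phi> (act g v) + c *s \<psi> (act g v) = act g (\<phi> v + c *s \<psi> v)" if "g \<in> carrier G" for g v
  proof -
    have "Vector_Spaces.linear (*s) (*s) (act g)"
      using act that unfolding linear_action_def by blast
    then show ?thesis
      using assms(2,3) that unfolding End_G_def by (simp add: vec.linear_add vec.linear_scale)
  qed
  ultimately show ?thesis
    unfolding End_G_def poly_map_def by simp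
qed

lemma self_differential_in_End_G:
  assumes act: "linear_action G act" and \<eta>: "\<eta> \<in> End_G G act"
  shows "(\<lambda>y. differential \<eta> y (\<eta> y)) \<in> End_G G act"
proof -
  have "differential \<eta> (act g v) (\<eta> (act g v)) = act g (differential \<eta> v (\<eta> v))"
    if "g \<in> carrier G" for g v
  proof -
    have "Vector_Spaces.linear (*s) (*s) (act g)"
      using act that unfolding linear_action_def by blast
    then show ?thesis
      using \<eta> that differential_equivariant[of \<eta> "act g"] unfolding End_G_def by simp
  qed
  then show ?thesis
    using \<eta> poly_map_self_differential unfolding End_G_def by blast
qed

definition vanishing_ideal :: "('k::field ^ 'n::finite) set \<Rightarrow> ('k ^ 'n \<Rightarrow> 'k) set" where
  "vanishing_ideal X = {f \<in> poly_fun. \<forall>y\<in>X. f y = 0}"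

lemma zariski_closed_vanishing_imp_mem:
  assumes "zariski_closed X" and "\<And>f. f \<in> vanishing_ideal X \<Longrightarrow> f x = 0"
  shows "x \<in> X"
proof -
  obtain F where "F \<subseteq> poly_fun" and X: "X = {x. \<forall>f\<in>F. f x = 0}"
    using assms(1) unfolding zariski_closed_def by blast
  then have "x \<in> {x. \<forall>f\<in>F. f x = 0}"
    using assms(2) unfolding vanishing_ideal_def by auto
  then show ?thesis
    using X by simp
qed

lemma taylor_coeff_in_vanishing_ideal:
  assumes act: "linear_action G act" and sym: "G_symmetric G act X"
    and f: "f \<in> vanishing_ideal X" and \<eta>: "\<eta> \<in> End_G G act"
  shows "taylor_coeff f \<eta> k \<in> vanishing_ideal X"
  using \<eta>
proof (induction k arbitrary: \<eta>)
  case 0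
  then show ?case using f by (simp add: taylor_coeff_0 vanishing_ideal_def)
next
  case (Suc k)
  have fp: "f \<in> poly_fun" using f unfolding vanishing_ideal_def by simp
  have \<eta>p: "poly_map \<eta>" using Suc.prems unfolding End_G_def by simp
  have "taylor_coeff f \<eta> (Suc k) x = 0" if x: "x \<in> X" for x
  proof -
    have "\<eta> x \<in> tangent_space X x"
      using sym x Suc.prems unfolding G_symmetric_def invariant_vector_field_iff_End_G by blast
    then have "dir_deriv (taylor_coeff f \<eta> k) x (\<eta> x) = 0"
      using Suc.IH[OF Suc.prems] unfolding tangent_space_def vanishing_ideal_def by blast
    moreover have "taylor_coeff f (\<lambda>y. \<eta> y + v *s differential \<eta> y (\<eta> y)) k x = 0" for v
      using Suc.IH[OF End_G_add_scale[OF act Suc.prems self_differential_in_End_G[OF act Suc.prems]]] x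
      unfolding vanishing_ideal_def by blast
    ultimately have "of_nat (Suc k) * taylor_coeff f \<eta> (Suc k) x = 0"
      using dir_deriv_taylor_coeff[OF fp \<eta>p, of k x] by simp
    then show ?thesis by (simp del: of_nat_Suc)
  qed
  then show ?case
    using poly_fun_taylor_coeff[OF fp \<eta>p] unfolding vanishing_ideal_def by blast
qed

lemma G_symmetric_imp_End_G_stable:
  fixes act :: "'g \<Rightarrow> 'k::field_char_0 ^ 'n::finite \<Rightarrow> 'k ^ 'n"
  assumes act: "linear_action G act" and "zariski_closed X" and sym: "G_symmetric G act X"
    and \<phi>: "\<phi> \<in> End_G G act"
  shows "\<phi> ` X \<subseteq> X"
proof
  fix y assume "y \<in> \<phi> ` X"
  then obtain x where x: "x \<in> X" and y: "y = \<phi> x" by blast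
  define \<eta> where "\<eta> = (\<lambda>z. \<phi> z + (-1) *s z)"
  have \<eta>: "\<eta> \<in> End_G G act"
    unfolding \<eta>_def by (rule End_G_add_scale[OF act \<phi> id_in_End_G])
  have "f y = 0" if f: "f \<in> vanishing_ideal X" for f
  proof -
    have "poly_of (\<lambda>t. f (x + t *s \<eta> x)) = 0"
      using taylor_coeff_in_vanishing_ideal[OF act sym f \<eta>] x
      by (intro poly_eqI) (simp add: taylor_coeff_def vanishing_ideal_def)
    then have "f (x + 1 *s \<eta> x) = 0"
      using f poly_poly_of[OF poly_function_comp_line, of f x "\<eta> x" 1]
      unfolding vanishing_ideal_def by simp
    then show ?thesis by (simp add: y \<eta>_def)
  qed
  then show "y \<in> X"
    by (rule zariski_closed_vanishing_imp_mem[OF \<open>zariski_closed X\<close>])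
qed

lemma End_G_stable_imp_G_symmetric:
  fixes act :: "'g \<Rightarrow> 'k::field_char_0 ^ 'n::finite \<Rightarrow> 'k ^ 'n"
  assumes act: "linear_action G act" and stable: "\<forall>\<phi> \<in> End_G G act. \<phi> ` X \<subseteq> X"
  shows "G_symmetric G act X"
  unfolding G_symmetric_def invariant_vector_field_iff_End_G
proof (intro allI impI ballI)
  fix \<xi> x assume \<xi>: "\<xi> \<in> End_G G act" and x: "x \<in> X"
  have line: "x + t *s \<xi> x \<in> X" for t
  proof -
    have "(\<lambda>y. y + t *s \<xi> y) ` X \<subseteq> X"
      by (rule bspec[OF stable End_G_add_scale[OF act id_in_End_G \<xi>]])
    then show ?thesis
      using x unfolding image_subset_iff by blast
  qed
  show "\<xi> x \<in> tangent_space X x"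
    unfolding tangent_space_def
  proof (intro CollectI ballI impI)
    fix f assume "f \<in> poly_fun" and "\<forall>y\<in>X. f y = 0"
    then have "(\<lambda>t. f (x + t *s \<xi> x)) = (\<lambda>t. 0)"
      using line by auto
    then show "dir_deriv f x (\<xi> x) = 0"
      by (simp add: dir_deriv_poly_of)
  qed
qed

theorem theorem4p2p2:
  fixes G :: "('g, 'b) monoid_scheme"
    and act :: "'g \<Rightarrow> 'k::{alg_closed_field, field_char_0} ^ 'n::finite \<Rightarrow> 'k ^ 'n"
    and X :: "('k ^ 'n) set"
  assumes "group G"
    and "linear_action G act"
    and "zariski_closed X"
  shows "G_symmetric G act X \<longleftrightarrow> (\<forall>\<phi> \<in> End_G G act. \<phi> ` X \<subseteq> X)"
  using G_symmetric_imp_End_G_stable[OF assms(2,3)] End_G_stable_imp_G_symmetric[OF assms(2)]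
  by blast

end
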